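(* Suppose reals $c_1>c_2>1$ and a positive integer $k$ satisfy $$\left(\frac{k}{2}-1\right)\left(\left(\frac{c_1}{c_2}\right)^{1/2}-1\right)\ge 2.$$ Let $G=(V,E)$ be a graph on more than $k$ vertices, having the following properties: (1) $|E(G)|\ge c_1|V(G)|$; (2) every subset $R$ of $V(G)$ of size $|R|\le k$ spans at most $c_2|R|$ edges in $G$. Then $G$ has a cycle of length at least $$\left(\frac{k}{2}-1\right)\left(\left(\frac{c_1}{c_2}\right)^{1/2}-1\right)+1.$$
   Context: Graphs are finite and simple. The number of edges spanned by a vertex subset $R$ is the number of edges of $G$ with both endpoints in $R$. The length of a cycle is its number of edges. *)

theory Defs
  imports Complex_Main
begin

definition simple_graph :: "'a set \<Rightarrow> 'a set set \<Rightarrow> bool" where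
  "simple_graph V E \<longleftrightarrow> finite V \<and> (\<forall>e\<in>E. e \<subseteq> V \<and> card e = 2)"

definition spanned_edges :: "'a set set \<Rightarrow> 'a set \<Rightarrow> 'a set set" where
  "spanned_edges E R = {e \<in> E. e \<subseteq> R}"

text \<open>
  A cycle is given by the list of its vertices in cyclic order, each vertex listed once;
  the closing edge joins the last vertex of the list to the first.
\<close>

definition cycle_edges :: "'a list \<Rightarrow> 'a set set" where
  "cycle_edges vs = {{vs ! i, vs ! (Suc i mod length vs)} | i. i < length vs}"

definition is_cycle :: "'a set \<Rightarrow> 'a set set \<Rightarrow> 'a list \<Rightarrow> bool" where
  "is_cycle V E vs \<longleftrightarrow>
     3 \<le> length vs \<and> distinct vs \<and> set vs \<subseteq> V \<and> cycle_edges vs \<subseteq> E"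

definition cycle_length :: "'a list \<Rightarrow> nat" where
  "cycle_length vs = card (cycle_edges vs)"

lemma cycle_length_eq_length:
  assumes "is_cycle V E vs"
  shows "cycle_length vs = length vs"
proof -
  let ?n = "length vs"
  let ?f = "\<lambda>i. {vs ! i, vs ! (Suc i mod ?n)}"
  have n: "3 \<le> ?n" and d: "distinct vs"
    using assms by (auto simp: is_cycle_def)
  have eq: "cycle_edges vs = ?f ` {..<?n}"
    by (auto simp: cycle_edges_def)
  have "inj_on ?f {..<?n}"
  proof (rule inj_onI)
    fix i j assume ij: "i \<in> {..<?n}" "j \<in> {..<?n}" and f: "?f i = ?f j"
    show "i = j"
    proof (rule ccontr)
      assume ne: "i \<noteq> j"
      have lt: "Suc i mod ?n < ?n" "Suc j mod ?n < ?n"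
        by (rule mod_less_divisor, use n in linarith)+
      have neq: "vs ! i \<noteq> vs ! j"
        using ne ij d by (simp add: nth_eq_iff_index_eq)
      have "vs ! i = vs ! (Suc j mod ?n)" "vs ! (Suc i mod ?n) = vs ! j"
        using f neq unfolding doubleton_eq_iff by blast+
      then have s: "i = Suc j mod ?n" "Suc i mod ?n = j"
        using nth_eq_iff_index_eq[OF d] ij lt by (metis lessThan_iff)+
      have mi: "Suc i mod ?n = (if Suc i = ?n then 0 else Suc i)"
        and mj: "Suc j mod ?n = (if Suc j = ?n then 0 else Suc j)"
        using ij by simp_all
      have "j = 0 \<and> Suc i = ?n \<or> j = Suc i" "i = 0 \<and> Suc j = ?n \<or> i = Suc j"
        using mi mj s by argo+
      then show False
        using n by linarith
    qed
  qed
  then show ?thesis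
    by (simp add: cycle_length_def eq card_image)
qed

end

theory Submission
  imports Defs
begin

text \<open>
  The cycle comes from an expansion property: if every vertex set \<open>W\<close> with \<open>m / 2 \<le> |W| \<le> m\<close>
  has at least \<open>t \<ge> 2\<close> outside neighbours, then a graph on at least \<open>m\<close> vertices has a cycle
  of length at least \<open>t + 1\<close> (\<open>long_cycle_if_expanding\<close>).  This is a depth-first search
  argument: extend a path \<open>P\<close>, always into a connected piece of more than \<open>m\<close> vertices
  hanging at its last vertex, until every remaining piece has at most \<open>m\<close> vertices.
  Some union \<open>W\<close> of these pieces has between \<open>m / 2\<close> and \<open>m\<close> vertices, and all its
  neighbours lie on \<open>P\<close>.  The neighbour that is farthest from the end of \<open>P\<close> cuts off a final
  segment of at least \<open>t\<close> vertices, which closes up to a cycle through \<open>W\<close>.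

  To obtain expansion, pass to a minimal nonempty vertex set \<open>U\<close> that spans at least \<open>c1 |U|\<close>
  edges.  By minimality every \<open>W \<subseteq> U\<close> meets at least \<open>c1 |W|\<close> of them, and local
  sparseness forces \<open>|U| > k\<close>.  Let \<open>W\<close> have between about \<open>k / 4\<close> and \<open>k / 2\<close> vertices and
  let \<open>N\<close> be its neighbourhood in \<open>U\<close>.
  If \<open>|W \<union> N| \<le> k\<close>, then sparseness of \<open>W \<union> N\<close> gives
  \<open>c1 |W| \<le> c2 (|W| + |N|)\<close>.  Otherwise choose the \<open>k - |W|\<close> vertices of \<open>N\<close> that send
  the most edges to \<open>W\<close>; together with \<open>W\<close> they span at least the fraction
  \<open>(k - |W|) / |N|\<close> of all edges at \<open>W\<close>, so \<open>c1 |W| (k - |W|) \<le> c2 k |N|\<close>.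
  In both cases \<open>|N| \<ge> (k/2 - 1) (sqrt (c1/c2) - 1)\<close>, and the cycle lemma applies with
  \<open>m = k div 2\<close>.
\<close>

section \<open>Paths and connected pieces inside a vertex set\<close>

definition nbrs :: "'a set set \<Rightarrow> 'a set \<Rightarrow> 'a set" where
  "nbrs E W = {y. y \<notin> W \<and> (\<exists>x\<in>W. {x, y} \<in> E)}"

definition linked :: "'a set set \<Rightarrow> 'a set \<Rightarrow> ('a \<times> 'a) set" where
  "linked E C = {(x, y). x \<in> C \<and> y \<in> C \<and> {x, y} \<in> E}\<^sup>*"

definition piece :: "'a set set \<Rightarrow> 'a set \<Rightarrow> 'a \<Rightarrow> 'a set" where
  "piece E C x = {y \<in> C. (x, y) \<in> linked E C}"

definition path_in :: "'a set set \<Rightarrow> 'a set \<Rightarrow> 'a list \<Rightarrow> bool" where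
  "path_in E C q \<longleftrightarrow>
     q \<noteq> [] \<and> distinct q \<and> set q \<subseteq> C \<and> successively (\<lambda>x y. {x, y} \<in> E) q"

lemma linked_sym: "(x, y) \<in> linked E C \<Longrightarrow> (y, x) \<in> linked E C"
proof -
  have "sym {(x, y). x \<in> C \<and> y \<in> C \<and> {x, y} \<in> E}"
    by (auto simp: sym_def insert_commute)
  then show "(x, y) \<in> linked E C \<Longrightarrow> (y, x) \<in> linked E C"
    unfolding linked_def by (meson sym_rtrancl symD)
qed

lemma linked_trans:
  "(x, y) \<in> linked E C \<Longrightarrow> (y, z) \<in> linked E C \<Longrightarrow> (x, z) \<in> linked E C"
  unfolding linked_def by (rule rtrancl_trans)

lemma linked_edge: "x \<in> C \<Longrightarrow> y \<in> C \<Longrightarrow> {x, y} \<in> E \<Longrightarrow> (x, y) \<in> linked E C"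
  unfolding linked_def by auto

lemma piece_self: "x \<in> C \<Longrightarrow> x \<in> piece E C x"
  unfolding piece_def linked_def by auto

lemma piece_subset: "piece E C x \<subseteq> C"
  unfolding piece_def by auto

lemma piece_closed:
  assumes "y \<in> piece E C x" "z \<in> C" "{y, z} \<in> E"
  shows "z \<in> piece E C x"
proof -
  have "(x, y) \<in> linked E C" "y \<in> C" using assms(1) by (auto simp: piece_def)
  then have "(x, z) \<in> linked E C" using linked_trans linked_edge[OF _ assms(2,3)] by metis
  then show ?thesis using assms(2) by (simp add: piece_def)
qed

lemma path_in_linked:
  "path_in E C q \<Longrightarrow> z \<in> set q \<Longrightarrow> (hd q, z) \<in> linked E C"
proof (induction q)
  case Nil
  then show ?case by simp
next
  case (Cons a q)
  show ?case
  proof (cases "z = a")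
    case True
    then show ?thesis by (simp add: linked_def)
  next
    case False
    then have "q \<noteq> []" "z \<in> set q" using Cons.prems by auto
    moreover from this Cons.prems have q: "path_in E C q" "{a, hd q} \<in> E" "a \<in> C" "hd q \<in> C"
      by (auto simp: path_in_def successively_Cons)
    ultimately have "(hd q, z) \<in> linked E C" using Cons.IH by blast
    then have "(a, z) \<in> linked E C" using linked_trans[OF linked_edge[OF q(3,4,2)]] by blast
    then show ?thesis by simp
  qed
qed

text \<open>A walk turns into a path by cutting it back to the first visit of each new vertex.\<close>

lemma linked_path:
  assumes "(x, y) \<in> linked E C" "x \<in> C"
  shows "\<exists>q. path_in E C q \<and> hd q = x \<and> last q = y"
  using assms(1) unfolding linked_def
proof (induction rule: rtrancl_induct)
  case base
  have "path_in E C [x]" using assms(2) by (simp add: path_in_def)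
  then show ?case by fastforce
next
  case (step y z)
  then obtain q where q: "path_in E C q" "hd q = x" "last q = y" by blast
  have yz: "z \<in> C" "{y, z} \<in> E" using step.hyps by auto
  show ?case
  proof (cases "z \<in> set q")
    case True
    then obtain us vs where "q = us @ z # vs" by (meson split_list)
    then have "path_in E C (us @ [z])" "hd (us @ [z]) = x"
      using q by (auto simp: path_in_def successively_append_iff hd_append)
    then show ?thesis by (metis last_snoc)
  next
    case False
    then have "path_in E C (q @ [z])" "hd (q @ [z]) = x"
      using q yz by (auto simp: path_in_def successively_append_iff)
    then show ?thesis by (metis last_snoc)
  qed
qed

text \<open>
  Removing a vertex \<open>u\<close> from its piece leaves parts that all hang at \<open>u\<close>; this is what lets the
  depth-first search continue from \<open>u\<close>.
\<close>

lemma path_after_removal: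
  assumes u: "u \<in> piece E C x" and w: "w \<in> piece E C x - {u}"
  shows "\<exists>q. path_in E (piece E C x - {u}) q \<and> {u, hd q} \<in> E \<and> last q = w"
proof -
  have "(u, w) \<in> linked E C" "u \<in> C"
    using u w linked_sym linked_trans unfolding piece_def by fast+
  then obtain q where q: "path_in E C q" "hd q = u" "last q = w"
    using linked_path by metis
  have "set q \<subseteq> piece E C x"
  proof
    fix z assume z: "z \<in> set q"
    then have "(u, z) \<in> linked E C" "z \<in> C"
      using path_in_linked[OF q(1)] q by (auto simp: path_in_def)
    then show "z \<in> piece E C x"
      using u linked_trans unfolding piece_def by fast
  qed
  moreover obtain q' where q': "q = u # q'"
    using q by (cases q) (auto simp: path_in_def)
  moreover have "q' \<noteq> []" using q q' w by auto
  ultimately have "path_in E (piece E C x - {u}) q'" "{u, hd q'} \<in> E" "last q' = w"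
    using q by (auto simp: path_in_def successively_Cons)
  then show ?thesis by blast
qed

text \<open>
  A union of pieces of medium size: take the largest union of size at most \<open>m\<close>.  If it is smaller
  than \<open>m / 2\<close>, adding any further piece exceeds \<open>m\<close>, so that piece alone has size
  more than \<open>m / 2\<close>.
\<close>

lemma medium_union_of_pieces:
  assumes fin: "finite C" and m: "m \<le> card C"
    and small: "\<And>x. x \<in> C \<Longrightarrow> card (piece E C x) \<le> m"
  shows "\<exists>W\<subseteq>C. nbrs E W \<inter> C = {} \<and> m \<le> 2 * card W \<and> card W \<le> m"
proof -
  define \<W> where "\<W> = {W. W \<subseteq> C \<and> nbrs E W \<inter> C = {} \<and> card W \<le> m}"
  have "{} \<in> \<W>" unfolding \<W>_def nbrs_def by simp
  moreover have "\<forall>X. X \<in> \<W> \<longrightarrow> card X < Suc m" unfolding \<W>_def by auto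
  ultimately have "\<exists>W. W \<in> \<W> \<and> (\<forall>X. X \<in> \<W> \<longrightarrow> card X \<le> card W)"
    by (rule ex_has_greatest_nat)
  then obtain W where W: "W \<in> \<W>" and max: "\<And>X. X \<in> \<W> \<Longrightarrow> card X \<le> card W"
    by auto
  show ?thesis
  proof (cases "m \<le> 2 * card W")
    case True
    then show ?thesis using W unfolding \<W>_def by blast
  next
    case False
    then have "W \<noteq> C" using m by auto
    then obtain x where x: "x \<in> C" "x \<notin> W"
      using W unfolding \<W>_def by blast
    let ?K = "piece E C x"
    have K: "nbrs E ?K \<inter> C = {}" "?K \<subseteq> C"
      using piece_closed[of _ E C x] piece_subset unfolding nbrs_def by fast+
    have "finite W" "finite ?K"
      using W K fin finite_subset unfolding \<W>_def by auto
    moreover have "x \<in> ?K" using x piece_self by fast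
    ultimately have "card W < card (W \<union> ?K)"
      using x by (intro psubset_card_mono) auto
    moreover have "nbrs E (W \<union> ?K) \<inter> C = {}" "W \<union> ?K \<subseteq> C"
      using W K unfolding \<W>_def nbrs_def by auto
    ultimately have "\<not> card (W \<union> ?K) \<le> m"
      using max[of "W \<union> ?K"] unfolding \<W>_def by force
    moreover have "card (W \<union> ?K) \<le> card W + card ?K" by (rule card_Un_le)
    ultimately have "m \<le> 2 * card ?K" using False by linarith
    then show ?thesis using K small[OF x(1)] by blast
  qed
qed

section \<open>Long cycles from expansion\<close>

lemma cycle_edges_of_path:
  assumes "successively (\<lambda>x y. {x, y} \<in> E) vs" "{last vs, hd vs} \<in> E"
  shows "cycle_edges vs \<subseteq> E"
proof -
  have "{vs ! i, vs ! (Suc i mod length vs)} \<in> E" if i: "i < length vs" for i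
  proof (cases "Suc i = length vs")
    case True
    then have "i = length vs - 1" "vs \<noteq> []" by auto
    then have "vs ! i = last vs" "vs ! 0 = hd vs" by (simp_all add: last_conv_nth hd_conv_nth)
    then show ?thesis using True assms(2) by simp
  next
    case False
    then have "Suc i < length vs" using i by simp
    then show ?thesis using assms(1) by (simp add: successively_conv_nth)
  qed
  then show ?thesis unfolding cycle_edges_def by blast
qed

text \<open>
  A state of the depth-first search: \<open>P\<close> is the current path from the root and \<open>C\<close> a set of
  vertices not yet visited that hangs below its last vertex, so that each of them can be reached
  from there through \<open>C\<close>.  A path through \<open>C\<close> ending in \<open>W\<close> is what later closes the cycle.  The search stops when all pieces of
  \<open>C\<close> have size at most \<open>m\<close>.  An empty \<open>P\<close> describes the start, where \<open>C\<close> need not be connected.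
\<close>

lemma long_cycle_from_search_state:
  fixes V :: "'a set" and E :: "'a set set"
  assumes finV: "finite V" and t: "2 \<le> t"
    and expand: "\<And>W. W \<subseteq> V \<Longrightarrow> m \<le> 2 * card W \<Longrightarrow> card W \<le> m \<Longrightarrow> t \<le> card (nbrs E W)"
    and "C \<subseteq> V" "set P \<subseteq> V" "set P \<inter> C = {}" "distinct P"
    and "successively (\<lambda>x y. {x, y} \<in> E) P"
    and "nbrs E C \<subseteq> set P" and "m \<le> card C"
    and "\<And>w. P \<noteq> [] \<Longrightarrow> w \<in> C \<Longrightarrow> \<exists>q. path_in E C q \<and> {last P, hd q} \<in> E \<and> last q = w"
  shows "\<exists>vs. is_cycle V E vs \<and> t + 1 \<le> length vs"
  using assms(4-)
proof (induction "card C" arbitrary: C P rule: less_induct)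
  case less
  note C = less.prems(1) and P = less.prems(2-5) and NC = less.prems(6) and mC = less.prems(7)
    and hang = less.prems(8)
  have finC: "finite C" using C finV finite_subset by blast
  show ?case
  proof (cases "\<exists>x\<in>C. m < card (piece E C x)")
    case True
    then obtain x where x: "x \<in> C" and big: "m < card (piece E C x)" by blast
    let ?D = "piece E C x"
    have "\<exists>u\<in>?D. P \<noteq> [] \<longrightarrow> {last P, u} \<in> E"
    proof (cases "P = []")
      case True
      then show ?thesis using piece_self[OF x] by blast
    next
      case False
      then obtain q where q: "path_in E C q" "{last P, hd q} \<in> E" "last q = x"
        using hang x by blast
      then have "(hd q, x) \<in> linked E C" "hd q \<in> C"
        using path_in_linked[OF q(1), of x] by (auto simp: path_in_def)
      then have "hd q \<in> ?D" using linked_sym unfolding piece_def by fast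
      then show ?thesis using q by blast
    qed
    then obtain u where u: "u \<in> ?D" and Pu: "P \<noteq> [] \<Longrightarrow> {last P, u} \<in> E" by blast
    have D: "?D \<subseteq> C" by (rule piece_subset)
    then have finD: "finite ?D" using finC finite_subset by blast
    have card: "card (?D - {u}) = card ?D - 1" using u finD by simp
    have cDC: "card ?D \<le> card C" by (rule card_mono[OF finC D])
    have nb: "nbrs E (?D - {u}) \<subseteq> set (P @ [u])"
    proof
      fix y assume "y \<in> nbrs E (?D - {u})"
      then obtain z where z: "y \<notin> ?D - {u}" "z \<in> ?D" "{z, y} \<in> E"
        unfolding nbrs_def by blast
      show "y \<in> set (P @ [u])"
      proof (cases "y \<in> C")
        case True
        then show ?thesis using z piece_closed by fastforce
      next
        case False
        then have "y \<in> nbrs E C" using z D unfolding nbrs_def by blast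
        then show ?thesis using NC by auto
      qed
    qed
    show ?thesis
    proof (rule less.hyps[of "?D - {u}" "P @ [u]"])
      show "card (?D - {u}) < card C" using card big cDC by linarith
      show "?D - {u} \<subseteq> V" using D C by blast
      show "set (P @ [u]) \<subseteq> V" "set (P @ [u]) \<inter> (?D - {u}) = {}" "distinct (P @ [u])"
        using P u D C by auto
      show "successively (\<lambda>x y. {x, y} \<in> E) (P @ [u])"
        using P Pu by (auto simp: successively_append_iff)
      show "m \<le> card (?D - {u})" using card big by linarith
      show "\<exists>q. path_in E (?D - {u}) q \<and> {last (P @ [u]), hd q} \<in> E \<and> last q = w"
        if "w \<in> ?D - {u}" for w
        using path_after_removal[OF u that] by simp
    qed (rule nb)
  next
    case False
    then have "\<And>x. x \<in> C \<Longrightarrow> card (piece E C x) \<le> m" by force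
    from medium_union_of_pieces[OF finC mC this] obtain W where
      W: "W \<subseteq> C" "nbrs E W \<inter> C = {}" "m \<le> 2 * card W" "card W \<le> m" by blast
    let ?N = "nbrs E W"
    have tN: "t \<le> card ?N" using expand W C by blast
    have NP: "?N \<subseteq> set P" using W NC unfolding nbrs_def by blast
    have "?N \<noteq> {}" using tN t by auto
    then obtain y where y: "y \<in> ?N" by blast
    then obtain j where j: "j < length P" "P ! j \<in> ?N" using NP by (metis in_set_conv_nth subsetD)
    \<comment> \<open>the neighbour of \<open>W\<close> on \<open>P\<close> that is closest to the root\<close>
    define i where "i = (LEAST i. i < length P \<and> P ! i \<in> ?N)"
    have i: "i < length P" "P ! i \<in> ?N"
      using LeastI[of "\<lambda>i. i < length P \<and> P ! i \<in> ?N" j] j unfolding i_def by auto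
    have imin: "i \<le> l" if "l < length P" "P ! l \<in> ?N" for l
      unfolding i_def using that by (intro Least_le) auto
    have "?N \<subseteq> set (drop i P)"
    proof
      fix z assume z: "z \<in> ?N"
      then obtain l where l: "l < length P" "P ! l = z" using NP by (metis in_set_conv_nth subsetD)
      then have "i \<le> l" using imin z by blast
      then have "drop i P ! (l - i) = z" "l - i < length (drop i P)" using l by auto
      then show "z \<in> set (drop i P)" by (metis nth_mem)
    qed
    then have "card ?N \<le> length (drop i P)"
      by (meson List.finite_set card_length card_mono le_trans)
    then have tl: "t \<le> length (drop i P)" using tN by linarith
    obtain w where w: "w \<in> W" "{w, P ! i} \<in> E" using i(2) unfolding nbrs_def by blast
    have "P \<noteq> []" using i by auto
    then obtain q where q: "path_in E C q" "{last P, hd q} \<in> E" "last q = w"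
      using hang w W by blast
    let ?vs = "drop i P @ q"
    have qne: "q \<noteq> []" using q by (simp add: path_in_def)
    have ne: "drop i P \<noteq> []" using i by simp
    have hd: "hd ?vs = P ! i" using i by (simp add: hd_drop_conv_nth)
    have "successively (\<lambda>x y. {x, y} \<in> E) (take i P @ drop i P)" using P by simp
    then have "successively (\<lambda>x y. {x, y} \<in> E) (drop i P)"
      unfolding successively_append_iff by blast
    then have "successively (\<lambda>x y. {x, y} \<in> E) ?vs"
      using q i by (auto simp: successively_append_iff path_in_def)
    moreover have "{last ?vs, hd ?vs} \<in> E" using hd qne q w by simp
    ultimately have "cycle_edges ?vs \<subseteq> E" by (rule cycle_edges_of_path)
    moreover have "distinct ?vs" "set ?vs \<subseteq> V"
      using P q C set_drop_subset[of i P] by (auto simp: path_in_def)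
    moreover have len: "t + 1 \<le> length ?vs" using tl qne by (cases q) auto
    ultimately have "is_cycle V E ?vs" unfolding is_cycle_def using t by simp
    then show ?thesis using len by blast
  qed
qed

lemma long_cycle_if_expanding:
  fixes V :: "'a set" and E :: "'a set set"
  assumes "simple_graph V E" "2 \<le> t" "m \<le> card V"
    and expand: "\<And>W. W \<subseteq> V \<Longrightarrow> m \<le> 2 * card W \<Longrightarrow> card W \<le> m \<Longrightarrow> t \<le> card (nbrs E W)"
  shows "\<exists>vs. is_cycle V E vs \<and> t + 1 \<le> length vs"
proof -
  have "finite V" using assms(1) by (simp add: simple_graph_def)
  moreover have "nbrs E V \<subseteq> set []"
  proof
    fix y assume "y \<in> nbrs E V"
    then obtain x where "{x, y} \<in> E" "y \<notin> V" unfolding nbrs_def by blast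
    moreover from this(1) have "{x, y} \<subseteq> V" using assms(1) unfolding simple_graph_def by blast
    ultimately show "y \<in> set []" by simp
  qed
  ultimately show ?thesis
    using assms(2,3) long_cycle_from_search_state[of V t m E V "[]"] expand by simp
qed

section \<open>Edges at a vertex set\<close>

lemma dense_subset_of_size:
  fixes f :: "'a \<Rightarrow> nat"
  assumes "finite N" "s \<le> card N"
  shows "\<exists>X\<subseteq>N. card X = s \<and> s * sum f N \<le> card N * sum f X"
  using assms(2)
proof (induction rule: inc_induct)
  case base
  show ?case by auto
next
  case (step s)
  then obtain X where X: "X \<subseteq> N" "card X = Suc s" "Suc s * sum f N \<le> card N * sum f X" by blast
  have finX: "finite X" using X assms(1) finite_subset by blast
  have "X \<noteq> {}" using X by auto
  \<comment> \<open>dropping a vertex of least weight does not lower the average\<close>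
  then obtain x where x: "x \<in> X" "\<And>y. y \<in> X \<Longrightarrow> f x \<le> f y"
    using arg_min_if_finite(1)[of X f] arg_min_least[of X _ f] finX by blast
  have fx: "sum f X = f x + sum f (X - {x})" using finX x by (simp add: sum.remove)
  have "s * f x \<le> sum f (X - {x})"
  proof -
    have "card (X - {x}) = s" using X x finX by simp
    then show ?thesis using sum_bounded_below[of "X - {x}" "f x" f] x by auto
  qed
  then have "s * sum f X \<le> Suc s * sum f (X - {x})" unfolding fx by (simp add: algebra_simps)
  then have drop: "card N * (s * sum f X) \<le> card N * (Suc s * sum f (X - {x}))"
    by (rule mult_le_mono2)
  have "s * (Suc s * sum f N) \<le> s * (card N * sum f X)" using X(3) by (rule mult_le_mono2)
  also have "\<dots> = card N * (s * sum f X)" by (rule mult.left_commute)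
  also note drop
  finally have "Suc s * (s * sum f N) \<le> Suc s * (card N * sum f (X - {x}))"
    by (simp only: mult.left_commute)
  then have "s * sum f N \<le> card N * sum f (X - {x})" by (simp only: Suc_mult_le_cancel1)
  moreover have "card (X - {x}) = s" using X x finX by simp
  ultimately show ?case using X by (intro exI[of _ "X - {x}"]) auto
qed

definition edges_at :: "'a set set \<Rightarrow> 'a set \<Rightarrow> 'a set set" where
  "edges_at E W = {e \<in> E. e \<inter> W \<noteq> {}}"

lemma edges_at_within:
  assumes "simple_graph V E" "e \<in> edges_at E W"
  shows "e \<subseteq> W \<union> nbrs E W"
proof
  fix y assume y: "y \<in> e"
  obtain w where w: "w \<in> e" "w \<in> W" using assms(2) unfolding edges_at_def by auto
  have e: "e \<in> E" "card e = 2" using assms unfolding edges_at_def simple_graph_def by auto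
  show "y \<in> W \<union> nbrs E W"
  proof (cases "y = w")
    case False
    then have "e = {w, y}" using e w y by (auto simp: card_2_iff)
    then show ?thesis using e w unfolding nbrs_def by blast
  qed (use w in auto)
qed

text \<open>
  An edge at \<open>W\<close> either lies in \<open>W\<close> or leaves it through exactly one neighbour of \<open>W\<close>.  Hence the
  edges at \<open>W\<close> inside \<open>W \<union> X\<close> are counted by a weight function on \<open>X\<close>, up to a constant.
\<close>

lemma card_edges_at_split:
  assumes G: "simple_graph V E" and X: "finite X" "X \<inter> W = {}"
  shows "card {e \<in> edges_at E W. e \<subseteq> W \<union> X}
    = card {e \<in> edges_at E W. e \<subseteq> W} + (\<Sum>y\<in>X. card {e \<in> edges_at E W. y \<in> e})"
proof -
  let ?F = "\<lambda>y. {e \<in> edges_at E W. y \<in> e}"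
  let ?I = "{e \<in> edges_at E W. e \<subseteq> W}"
  have "E \<subseteq> Pow V" "finite V" using G unfolding simple_graph_def by auto
  then have finE: "finite (edges_at E W)"
    unfolding edges_at_def by (auto intro: finite_subset)
  have edge: "e = {w, y}" if "e \<in> edges_at E W" "y \<in> e" "w \<in> e" "y \<noteq> w" for e w y
  proof -
    have "card e = 2" using that G unfolding edges_at_def simple_graph_def by auto
    then show ?thesis using that by (auto simp: card_2_iff)
  qed
  have only: "e - {y} \<subseteq> W" if e: "e \<in> edges_at E W" "y \<in> e" "y \<notin> W" for e y
  proof -
    obtain w where "w \<in> e" "w \<in> W" using e unfolding edges_at_def by auto
    then have "e = {w, y}" using edge e by metis
    then show ?thesis using \<open>w \<in> W\<close> by auto
  qed
  have "{e \<in> edges_at E W. e \<subseteq> W \<union> X} = ?I \<union> (\<Union>y\<in>X. ?F y)" (is "?L = ?R")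
  proof
    show "?L \<subseteq> ?R" by blast
    show "?R \<subseteq> ?L"
    proof
      fix e assume "e \<in> ?R"
      then consider "e \<in> ?I" | y where "y \<in> X" "e \<in> ?F y" by blast
      then show "e \<in> ?L"
      proof cases
        case 2
        then have "e - {y} \<subseteq> W" using only X(2) by blast
        then show ?thesis using 2 by blast
      qed auto
    qed
  qed
  moreover have "?I \<inter> (\<Union>y\<in>X. ?F y) = {}" using X(2) by blast
  moreover have "card (\<Union>y\<in>X. ?F y) = (\<Sum>y\<in>X. card (?F y))"
  proof (rule card_UN_disjoint)
    show "\<forall>y\<in>X. \<forall>z\<in>X. y \<noteq> z \<longrightarrow> ?F y \<inter> ?F z = {}" using only X(2) by blast
  qed (use X finE in auto)
  moreover have "finite ?I" "finite (\<Union>y\<in>X. ?F y)" using finE X by auto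
  ultimately show ?thesis by (simp add: card_Un_disjoint)
qed

text \<open>
  The averaging step: among the neighbours of \<open>W\<close>, the \<open>s\<close> best connected ones already account
  for the fraction \<open>s / |N(W)|\<close> of the edges at \<open>W\<close>.
\<close>

lemma dense_part_of_neighbourhood:
  assumes G: "simple_graph V E" and fin: "finite (nbrs E W)" and s: "s \<le> card (nbrs E W)"
  shows "\<exists>X\<subseteq>nbrs E W. card X = s \<and>
    s * card (edges_at E W) \<le> card (nbrs E W) * card (spanned_edges E (W \<union> X))"
proof -
  let ?N = "nbrs E W" and ?f = "\<lambda>y. card {e \<in> edges_at E W. y \<in> e}"
  let ?a = "card {e \<in> edges_at E W. e \<subseteq> W}"
  have dis: "?N \<inter> W = {}" unfolding nbrs_def by auto
  have finE: "finite E"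
  proof -
    have "E \<subseteq> Pow V" "finite V" using G unfolding simple_graph_def by auto
    then show ?thesis by (meson finite_Pow_iff finite_subset)
  qed
  obtain X where X: "X \<subseteq> ?N" "card X = s" "s * sum ?f ?N \<le> card ?N * sum ?f X"
    using dense_subset_of_size[OF fin s, of ?f] by blast
  have "{e \<in> edges_at E W. e \<subseteq> W \<union> ?N} = edges_at E W" using edges_at_within[OF G] by blast
  then have total: "card (edges_at E W) = ?a + sum ?f ?N"
    using card_edges_at_split[OF G fin dis] by simp
  have "finite X" "X \<inter> W = {}" using X(1) fin dis finite_subset by auto
  then have "?a + sum ?f X = card {e \<in> edges_at E W. e \<subseteq> W \<union> X}"
    using card_edges_at_split[OF G, of X W] by simp
  also have "\<dots> \<le> card (spanned_edges E (W \<union> X))"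
    using finE unfolding spanned_edges_def edges_at_def by (intro card_mono) auto
  finally have part: "?a + sum ?f X \<le> card (spanned_edges E (W \<union> X))" .
  have "s * card (edges_at E W) = s * ?a + s * sum ?f ?N"
    unfolding total by (rule distrib_left)
  also have "\<dots> \<le> card ?N * ?a + card ?N * sum ?f X"
    using mult_le_mono1[OF s] X(3) by (rule add_le_mono)
  also have "\<dots> = card ?N * (?a + sum ?f X)" by (rule distrib_left[symmetric])
  also have "\<dots> \<le> card ?N * card (spanned_edges E (W \<union> X))"
    using part by (rule mult_le_mono2)
  finally show ?thesis using X(1,2) by blast
qed

section \<open>Expansion from density and local sparseness\<close>

text \<open>
  Removing \<open>W\<close> from a minimal nonempty set of edge density at least \<open>c\<close> lowers the density below
  \<open>c\<close>, so \<open>W\<close> must meet many edges.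
\<close>

lemma dense_core:
  fixes c :: real
  assumes G: "simple_graph V E" and "V \<noteq> {}" "c * card V \<le> card E"
  obtains U where "U \<subseteq> V" "U \<noteq> {}" "c * card U \<le> card (spanned_edges E U)"
    "\<And>W. W \<subseteq> U \<Longrightarrow> c * card W \<le> card (edges_at (spanned_edges E U) W)"
proof -
  let ?D = "\<lambda>U. U \<subseteq> V \<and> U \<noteq> {} \<and> c * card U \<le> card (spanned_edges E U)"
  have finV: "finite V" and finE: "finite E"
  proof -
    have "E \<subseteq> Pow V" "finite V" using G unfolding simple_graph_def by auto
    then show "finite E" "finite V" by (auto intro: finite_subset)
  qed
  have "spanned_edges E V = E" using G unfolding spanned_edges_def simple_graph_def by auto
  then have "?D V" using assms by simp
  then obtain U where U: "?D U" and min: "\<And>X. ?D X \<Longrightarrow> card U \<le> card X"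
    using ex_has_least_nat[of ?D V card] by blast
  have "c * card W \<le> card (edges_at (spanned_edges E U) W)" if W: "W \<subseteq> U" for W
  proof -
    let ?A = "edges_at (spanned_edges E U) W" and ?B = "spanned_edges E (U - W)"
    have finU: "finite U" using U finV finite_subset by blast
    then have finW: "finite W" using W finite_subset by blast
    have dec: "spanned_edges E U = ?A \<union> ?B" and "?A \<inter> ?B = {}"
      using W unfolding edges_at_def spanned_edges_def by auto
    moreover have "finite ?A" "finite ?B"
      using finE unfolding edges_at_def spanned_edges_def by auto
    ultimately have "card (?A \<union> ?B) = card ?A + card ?B"
      by (intro card_Un_disjoint)
    then have split: "card (spanned_edges E U) = card ?A + card ?B"
      by (rule trans[OF arg_cong[OF dec, of card]])
    have cU: "card U = card W + card (U - W)"
      using W finU finW by (metis card_Diff_subset card_mono le_add_diff_inverse)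
    show ?thesis
    proof (cases "W = {}")
      case False
      have "real (card ?B) \<le> c * card (U - W)"
      proof (cases "U - W = {}")
        case True
        have "{} \<notin> E" using G unfolding simple_graph_def by (metis card.empty zero_neq_numeral)
        then have "?B = {}" unfolding True by (simp add: spanned_edges_def)
        then show ?thesis unfolding True by simp
      next
        case nonempty: False
        have "card (U - W) < card U" using cU False finW by (simp add: card_gt_0_iff)
        then have "\<not> ?D (U - W)" using min[of "U - W"] by linarith
        moreover have "U - W \<subseteq> V" using U by blast
        ultimately show ?thesis using nonempty by linarith
      qed
      moreover have "c * card W + c * card (U - W) \<le> card (spanned_edges E U)"
        using U cU by (simp add: distrib_left)
      ultimately show ?thesis using split by simp
    qed simp
  qed
  then show ?thesis using U by (intro that[of U]) simp_all
qed

text \<open>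
  The arithmetic of the expansion bound, with \<open>\<rho> = sqrt (c1 / c2)\<close>, \<open>w = |W|\<close> and \<open>n = |N(W)|\<close>.
  The factorisation \<open>\<rho>\<^sup>2 - 1 = (\<rho> + 1) (\<rho> - 1)\<close> with \<open>\<rho> + 1 > 2\<close> makes up for \<open>w\<close> being only a
  quarter of \<open>k\<close>.
\<close>

lemma bound_if_closed_neighbourhood_small:
  fixes \<rho> w n k :: real
  assumes "1 < \<rho>" "1 \<le> k" "k \<le> 4 * w + 1" "\<rho>\<^sup>2 * w \<le> w + n"
  shows "(k / 2 - 1) * (\<rho> - 1) \<le> n"
proof -
  have "(k / 2 - 1) * (\<rho> - 1) \<le> (k - 1) / 2 * (\<rho> - 1)"
    using assms by (intro mult_right_mono) auto
  also have "\<dots> \<le> 2 * w * (\<rho> - 1)" using assms by (intro mult_right_mono) auto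
  also have "\<dots> \<le> (\<rho> + 1) * (w * (\<rho> - 1))"
  proof -
    have "0 \<le> w * (\<rho> - 1)" using assms by simp
    then show ?thesis using mult_right_mono[of 2 "\<rho> + 1" "w * (\<rho> - 1)"] assms by simp
  qed
  also have "\<dots> \<le> n" using assms(4) by (simp add: algebra_simps power2_eq_square)
  finally show ?thesis .
qed

text \<open>
  The product \<open>(k - w) w\<close> increases for \<open>w \<le> k / 2\<close>, so its value at the smallest admissible
  \<open>w = (k - 1) / 4\<close> bounds it from below; this gives about \<open>n \<ge> 3/16 \<rho>\<^sup>2 k\<close>, which exceeds
  \<open>(\<rho> - 1) k / 2\<close> for every \<open>\<rho>\<close>.
\<close>

lemma bound_if_closed_neighbourhood_large:
  fixes \<rho> w n k :: real
  assumes "1 < \<rho>" "1 \<le> k" "k \<le> 4 * w + 1" "2 * w \<le> k" "(k - w) * (\<rho>\<^sup>2 * w) \<le> n * k"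
  shows "(k / 2 - 1) * (\<rho> - 1) \<le> n"
proof -
  define a where "a = (k - 1) / 4"
  have "a \<le> w" using assms(3) unfolding a_def by simp
  moreover have "w \<le> k - a" using assms(2-4) unfolding a_def by (simp add: field_simps)
  ultimately have "0 \<le> (w - a) * (k - a - w)" by (intro mult_nonneg_nonneg) auto
  then have "a * (k - a) \<le> (k - w) * w" by (simp add: algebra_simps)
  moreover have "a * (3 / 4 * k) \<le> a * (k - a)"
    using assms unfolding a_def by (intro mult_left_mono) auto
  ultimately have "\<rho>\<^sup>2 * (a * (3 / 4 * k)) \<le> \<rho>\<^sup>2 * ((k - w) * w)" by (intro mult_left_mono) auto
  then have "(\<rho>\<^sup>2 * (3 / 4 * a)) * k \<le> n * k" using assms(5) by (simp add: ac_simps)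
  then have "\<rho>\<^sup>2 * (3 / 4 * a) \<le> n" using assms(2) by simp
  \<comment> \<open>the quadratic \<open>3 x\<^sup>2 - 8 x + 8\<close> has negative discriminant\<close>
  moreover have "2 * (\<rho> - 1) * a \<le> \<rho>\<^sup>2 * 3 / 4 * a"
  proof (rule mult_right_mono)
    have "0 \<le> (3 * \<rho> - 4)\<^sup>2" by simp
    then show "2 * (\<rho> - 1) \<le> \<rho>\<^sup>2 * 3 / 4" by (simp add: power2_eq_square algebra_simps)
  qed (use assms a_def in auto)
  moreover have "(k / 2 - 1) * (\<rho> - 1) \<le> (2 * a) * (\<rho> - 1)"
    using assms unfolding a_def by (intro mult_right_mono) auto
  moreover have "(2 * a) * (\<rho> - 1) = 2 * (\<rho> - 1) * a"
    and "\<rho>\<^sup>2 * (3 / 4 * a) = \<rho>\<^sup>2 * 3 / 4 * a" by simp_all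
  ultimately show ?thesis by linarith
qed

lemma large_neighbourhood:
  fixes c1 c2 :: real and k :: nat
  assumes G: "simple_graph U F" and c: "c2 < c1" "0 < c2" and W: "W \<subseteq> U"
    and at: "c1 * card W \<le> card (edges_at F W)"
    and sparse: "\<And>R. R \<subseteq> U \<Longrightarrow> card R \<le> k \<Longrightarrow> card (spanned_edges F R) \<le> c2 * card R"
    and k: "1 \<le> k" "k \<le> 4 * card W + 1" "2 * card W \<le> k"
  shows "(real k / 2 - 1) * (sqrt (c1 / c2) - 1) \<le> card (nbrs F W)"
proof -
  let ?N = "nbrs F W" and ?w = "real (card W)" and ?l = "sqrt (c1 / c2)"
  have l: "1 < ?l" "?l\<^sup>2 = c1 / c2" using c by simp_all
  have kr: "real k \<le> 4 * ?w + 1" "2 * ?w \<le> real k" "1 \<le> real k" using k by linarith+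
  have NU: "?N \<subseteq> U" using G unfolding nbrs_def simple_graph_def by blast
  have finU: "finite U" using G by (simp add: simple_graph_def)
  have fin: "finite W" "finite ?N" using finU W NU finite_subset by auto
  have finF: "finite F"
  proof -
    have "F \<subseteq> Pow U" using G unfolding simple_graph_def by auto
    then show ?thesis using finU by (meson finite_Pow_iff finite_subset)
  qed
  have dis: "W \<inter> ?N = {}" unfolding nbrs_def by auto
  show ?thesis
  proof (cases "card W + card ?N \<le> k")
    case True
    have cR: "card (W \<union> ?N) = card W + card ?N" using fin dis by (rule card_Un_disjoint)
    have "edges_at F W \<subseteq> spanned_edges F (W \<union> ?N)"
      using edges_at_within[OF G] unfolding spanned_edges_def edges_at_def by blast
    then have "card (edges_at F W) \<le> card (spanned_edges F (W \<union> ?N))"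
      using finF unfolding spanned_edges_def by (intro card_mono) auto
    also have "real \<dots> \<le> c2 * card (W \<union> ?N)" using sparse[of "W \<union> ?N"] W NU True cR by auto
    finally have "c1 * ?w \<le> c2 * (?w + card ?N)" using at cR by simp
    then have "?l\<^sup>2 * ?w \<le> ?w + card ?N" using c l by (simp add: field_simps)
    then show ?thesis using bound_if_closed_neighbourhood_small l kr by blast
  next
    case False
    then have "k - card W \<le> card ?N" by linarith
    then obtain X where X: "X \<subseteq> ?N" "card X = k - card W"
      "(k - card W) * card (edges_at F W) \<le> card ?N * card (spanned_edges F (W \<union> X))"
      using dense_part_of_neighbourhood[OF G fin(2)] by blast
    have "finite X" "W \<inter> X = {}" using X fin dis finite_subset by auto
    then have cR: "card (W \<union> X) = k" using X(2) k fin by (simp add: card_Un_disjoint)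
    have "real (card (spanned_edges F (W \<union> X))) \<le> c2 * k"
      using sparse[of "W \<union> X"] W NU X cR by auto
    then have "card ?N * real (card (spanned_edges F (W \<union> X))) \<le> card ?N * (c2 * k)"
      by (intro mult_left_mono) auto
    moreover have "(real k - ?w) * card (edges_at F W)
        \<le> card ?N * real (card (spanned_edges F (W \<union> X)))"
    proof -
      have "real ((k - card W) * card (edges_at F W))
          \<le> real (card ?N * card (spanned_edges F (W \<union> X)))"
        using X(3) by (rule of_nat_mono)
      then show ?thesis using k by (simp add: of_nat_diff)
    qed
    moreover have "(real k - ?w) * (c1 * ?w) \<le> (real k - ?w) * card (edges_at F W)"
      using at kr by (intro mult_left_mono) auto
    ultimately have "(real k - ?w) * (c1 * ?w) \<le> card ?N * (c2 * k)" by linarith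
    then have "(real k - ?w) * (?l\<^sup>2 * ?w) \<le> card ?N * real k"
      using c l by (simp add: field_simps)
    then show ?thesis using bound_if_closed_neighbourhood_large l kr by blast
  qed
qed

theorem theorem2:
  fixes c1 c2 :: real and k :: nat and V :: "'a set" and E :: "'a set set"
  assumes "c1 > c2" and "c2 > 1" and "k > 0"
    and "(real k / 2 - 1) * (sqrt (c1 / c2) - 1) \<ge> 2"
    and "simple_graph V E"
    and "card V > k"
    and "real (card E) \<ge> c1 * real (card V)"
    and "\<And>R. R \<subseteq> V \<Longrightarrow> card R \<le> k \<Longrightarrow>
           real (card (spanned_edges E R)) \<le> c2 * real (card R)"
  shows "\<exists>vs. is_cycle V E vs \<and>
           real (cycle_length vs) \<ge> (real k / 2 - 1) * (sqrt (c1 / c2) - 1) + 1"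
proof -
  let ?\<tau> = "(real k / 2 - 1) * (sqrt (c1 / c2) - 1)"
  have "V \<noteq> {}" using assms(6) by auto
  then obtain U where U: "U \<subseteq> V" "U \<noteq> {}" "c1 * card U \<le> card (spanned_edges E U)"
    and at: "\<And>W. W \<subseteq> U \<Longrightarrow> c1 * card W \<le> card (edges_at (spanned_edges E U) W)"
    using dense_core[OF assms(5) _ assms(7)] by blast
  let ?F = "spanned_edges E U"
  have finU: "finite U" using U(1) assms(5) finite_subset unfolding simple_graph_def by blast
  then have G: "simple_graph U ?F"
    using assms(5) unfolding simple_graph_def spanned_edges_def by auto
  have sparse: "card (spanned_edges ?F R) \<le> c2 * card R" if "R \<subseteq> U" "card R \<le> k" for R
  proof -
    have "spanned_edges ?F R = spanned_edges E R" using that unfolding spanned_edges_def by auto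
    then show ?thesis using assms(8)[of R] that U by auto
  qed
  have "k < card U"
  proof (rule ccontr)
    assume "\<not> k < card U"
    then have "c1 * card U \<le> c2 * card U" using U assms(8)[of U] by linarith
    moreover have "0 < card U" using U finU by (simp add: card_gt_0_iff)
    ultimately show False using assms(1) by simp
  qed
  then have "k div 2 \<le> card U" by linarith
  moreover have "nat \<lceil>?\<tau>\<rceil> \<le> card (nbrs ?F W)"
    if "W \<subseteq> U" "k div 2 \<le> 2 * card W" "card W \<le> k div 2" for W
  proof -
    have "?\<tau> \<le> card (nbrs ?F W)"
      using assms that by (intro large_neighbourhood[OF G _ _ that(1) at sparse]) auto
    then show ?thesis by linarith
  qed
  moreover have "2 \<le> nat \<lceil>?\<tau>\<rceil>" using assms(4) by linarith
  ultimately obtain vs where vs: "is_cycle U ?F vs" "nat \<lceil>?\<tau>\<rceil> + 1 \<le> length vs"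
    using long_cycle_if_expanding[OF G] by blast
  have "is_cycle V E vs" using vs(1) U(1) unfolding is_cycle_def spanned_edges_def by auto
  moreover have "?\<tau> + 1 \<le> length vs" using vs(2) by linarith
  ultimately show ?thesis by (metis cycle_length_eq_length)
qed

end
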